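(* Let $C,A_1,\dots,A_r\in\mathbb{S}^n$ and $b\in\mathbb{R}^r$, and consider the semidefinite program $$(\mathrm{SDP})\quad \min_{X\in\mathbb{S}^n}\ \langle C,X\rangle\quad\text{s.t. } \langle A_i,X\rangle=b_i\ \ \forall i\in[r],\quad X\succeq 0,$$ with dual $$(\mathrm{DSDP})\quad \max_{y\in\mathbb{R}^r}\ b^\top y\quad\text{s.t. } C-\sum_{i=1}^r y_iA_i\succeq 0,$$ both assumed strictly feasible. Suppose that there exist vectors $q^1,q^2\in\mathbb{R}^r$ with disjoint supports such that $\sum_{j=1}^r q^1_jA_j=I_n$ and such that the matrices $C$ and $\sum_{j=1}^r q^2_jA_j$ commute, and therefore are simultaneously diagonalizable by some orthogonal matrix $U$. Let $\mathcal{S}$ be the set of columns of such a $U$. Then the optimal value $z$ of the linear program $$(L_{\mathcal{S}})\quad \min_{X\in\mathbb{S}^n}\ \langle C,X\rangle\quad\text{s.t. } \langle A_i,X\rangle=b_i\ \ \forall i\in[r],\quad v^\top Xv\ge 0\ \ \forall v\in\mathcal{S}$$ satisfies the bound $$\Big(\sum_{j=1}^r b_jq^2_j\Big)x+\Big(\sum_{j=1}^r b_jq^1_j\Big)t\ \le\ z$$ for any $x,t\in\mathbb{R}$ such that the matrix $C-x\big(\sum_{j=1}^r q^2_jA_j\big)-tI_n$ is positive semidefinite.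
   Context: $\mathbb{S}^n$ is the set of real symmetric $n\times n$ matrices, $\langle A,B\rangle=\mathrm{tr}(AB)$, $[r]=\{1,\dots,r\}$, $I_n$ is the identity matrix, and $X\succeq0$ means positive semidefinite. An orthogonal matrix $U$ simultaneously diagonalizes matrices $B_1,B_2$ if $U^\top B_1U$ and $U^\top B_2U$ are both diagonal. The support of $q\in\mathbb{R}^r$ is $\{j: q_j\ne0\}$. Strict feasibility means: there is a positive definite $X$ with $\langle A_i,X\rangle=b_i$ for all $i$, and there is $y\in\mathbb{R}^r$ with $C-\sum_i y_iA_i$ positive definite. *)

theory Defs
  imports "HOL-Analysis.Analysis"
begin

definition symmetric_matrix :: "real^'n^'n \<Rightarrow> bool" where
  "symmetric_matrix A \<longleftrightarrow> transpose A = A"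

definition trace_inner :: "real^'n^'n \<Rightarrow> real^'n^'n \<Rightarrow> real" where
  "trace_inner A B = trace (A ** B)"

definition pos_semidef :: "real^'n^'n \<Rightarrow> bool" where
  "pos_semidef X \<longleftrightarrow> symmetric_matrix X \<and> (\<forall>v. v \<bullet> (X *v v) \<ge> 0)"

definition pos_def :: "real^'n^'n \<Rightarrow> bool" where
  "pos_def X \<longleftrightarrow> symmetric_matrix X \<and> (\<forall>v. v \<noteq> 0 \<longrightarrow> v \<bullet> (X *v v) > 0)"

definition diagonal_matrix :: "real^'n^'n \<Rightarrow> bool" where
  "diagonal_matrix D \<longleftrightarrow> (\<forall>i j. i \<noteq> j \<longrightarrow> D $ i $ j = 0)"

definition simultaneously_diagonalizes ::
    "real^'n^'n \<Rightarrow> real^'n^'n \<Rightarrow> real^'n^'n \<Rightarrow> bool" where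
  "simultaneously_diagonalizes U B1 B2 \<longleftrightarrow>
     orthogonal_matrix U \<and>
     diagonal_matrix (transpose U ** B1 ** U) \<and> diagonal_matrix (transpose U ** B2 ** U)"

definition support :: "real^'r \<Rightarrow> 'r set" where
  "support q = {j. q $ j \<noteq> 0}"

definition lin_comb :: "('r::finite \<Rightarrow> real^'n^'n) \<Rightarrow> real^'r \<Rightarrow> real^'n^'n" where
  "lin_comb A q = (\<Sum>j\<in>UNIV. q $ j *\<^sub>R A j)"

definition sdp_strictly_feasible :: "('r::finite \<Rightarrow> real^'n^'n) \<Rightarrow> real^'r \<Rightarrow> bool" where
  "sdp_strictly_feasible A b \<longleftrightarrow> (\<exists>X. pos_def X \<and> (\<forall>i. trace_inner (A i) X = b $ i))"

definition dsdp_strictly_feasible :: "real^'n^'n \<Rightarrow> ('r::finite \<Rightarrow> real^'n^'n) \<Rightarrow> bool" where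
  "dsdp_strictly_feasible C A \<longleftrightarrow> (\<exists>y. pos_def (C - lin_comb A y))"

definition lp_feasible ::
    "('r::finite \<Rightarrow> real^'n^'n) \<Rightarrow> real^'r \<Rightarrow> (real^'n) set \<Rightarrow> (real^'n^'n) set" where
  "lp_feasible A b S =
     {X. symmetric_matrix X \<and> (\<forall>i. trace_inner (A i) X = b $ i) \<and>
         (\<forall>v\<in>S. v \<bullet> (X *v v) \<ge> 0)}"

(* Extended-real infimum: infinity for an infeasible, -infinity for an unbounded program;
   the infimum over the reals would be an unspecified number in those cases. *)
definition lp_optimal_value ::
    "real^'n^'n \<Rightarrow> ('r::finite \<Rightarrow> real^'n^'n) \<Rightarrow> real^'r \<Rightarrow> (real^'n) set \<Rightarrow> ereal" where
  "lp_optimal_value C A b S = (INF X\<in>lp_feasible A b S. ereal (trace_inner C X))"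

end

theory Submission
  imports Defs
begin

text \<open>
  The LP bound is weak duality, and it works because the dual slack matrix is diagonal in the basis
  to which the LP constraints refer.  Put \<open>M = C - x Q - t I\<close> with \<open>Q = \<Sum>\<^sub>j q2\<^sub>j A\<^sub>j\<close>
  and \<open>I = \<Sum>\<^sub>j q1\<^sub>j A\<^sub>j\<close>.  For an LP-feasible \<open>X\<close> the equality constraints turn
  \<open>\<langle>C, X\<rangle>\<close> minus the claimed bound into \<open>\<langle>M, X\<rangle>\<close>.  Since \<open>U\<close> diagonalizes both \<open>C\<close> and
  \<open>Q\<close>, it diagonalizes \<open>M\<close>, so only the diagonal entries of \<open>U\<^sup>T X U\<close> contribute to the trace:
  \<open>\<langle>M, X\<rangle> = \<Sum>\<^sub>k (u\<^sub>k \<bullet> M u\<^sub>k) (u\<^sub>k \<bullet> X u\<^sub>k)\<close>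
  over the columns \<open>u\<^sub>k\<close> of \<open>U\<close>
  (\<open>trace_inner_diagonalized\<close>).  The first factors are nonnegative because \<open>M\<close> is positive
  semidefinite, the second ones by the LP constraints.

  The existence of \<open>U\<close> is the spectral theorem for two commuting symmetric matrices.  A maximizer
  of the quadratic form on the unit sphere of an invariant subspace is an eigenvector
  (\<open>selfadjoint_eigenvector\<close>).  An eigenspace of one operator is invariant under the other, so
  a second application inside that eigenspace yields a common eigenvector
  (\<open>commuting_selfadjoint_eigenvector\<close>).  Splitting it off leaves its orthogonal complement,
  which is again invariant, and induction on the dimension produces an orthonormal basis of common
  eigenvectors.
\<close>

section \<open>Orthonormal bases of common eigenvectors\<close>

text \<open>The first-order optimality condition at a minimum, in the one-variable form that applies
  along a line through a maximizer of the quadratic form.\<close>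

lemma nonneg_quadratic_no_linear_term:
  fixes a c :: real
  assumes nonneg: "\<And>s. 0 \<le> 2 * s * a + s\<^sup>2 * c"
  shows "a = 0"
proof (rule ccontr)
  assume "a \<noteq> 0"
  define d where "d = \<bar>c\<bar> + 1"
  have "d > 0" "c < d" by (auto simp: d_def)
  \<comment> \<open>at this point the linear term is twice as large as the bound on the quadratic one\<close>
  have "2 * (- (a / d)) * a + (- (a / d))\<^sup>2 * c = (a\<^sup>2 / d) * (c / d - 2)"
    using \<open>d > 0\<close> by (simp add: field_simps power2_eq_square)
  moreover have "c / d - 2 < 0" using \<open>c < d\<close> \<open>d > 0\<close> by (simp add: field_simps)
  moreover have "a\<^sup>2 / d > 0" using \<open>a \<noteq> 0\<close> \<open>d > 0\<close> by simp
  ultimately have "2 * (- (a / d)) * a + (- (a / d))\<^sup>2 * c < 0"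
    by (simp only: mult_pos_neg)
  with nonneg[of "- (a / d)"] show False by linarith
qed

text \<open>The eigenvalue is the maximum \<open>m\<close> of the quadratic form on the unit sphere of the
  subspace.  The form \<open>m (y \<bullet> y) - y \<bullet> f y\<close> is then nonnegative and vanishes at the maximizer
  \<open>x\<close>; moving from \<open>x\<close> in the direction of its gradient shows that this gradient,
  \<open>m x - f x\<close> up to a factor, is zero.\<close>

lemma selfadjoint_eigenvector:
  fixes f :: "'a::euclidean_space \<Rightarrow> 'a"
  assumes lin: "linear f" and sa: "\<And>x y. f x \<bullet> y = x \<bullet> f y"
    and S: "subspace S" "S \<noteq> {0}" and inv: "\<And>x. x \<in> S \<Longrightarrow> f x \<in> S"
  obtains x m where "x \<in> S" "norm x = 1" "f x = m *\<^sub>R x"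
proof -
  interpret linear f by (rule lin)
  let ?K = "S \<inter> sphere 0 1"
  have normalize: "y /\<^sub>R norm y \<in> ?K" if "y \<in> S" "y \<noteq> 0" for y
    using that S by (simp add: subspace_scale)
  obtain z where "z \<in> S" "z \<noteq> 0" using S subspace_0 by blast
  then have "?K \<noteq> {}" using normalize by blast
  moreover have "compact ?K"
    by (intro closed_Int_compact closed_subspace S compact_sphere)
  moreover have "continuous_on ?K (\<lambda>y. y \<bullet> f y)"
    by (intro continuous_intros linear_continuous_on linear_conv_bounded_linear[THEN iffD1] lin)
  ultimately obtain x where x: "x \<in> ?K" and max: "\<And>y. y \<in> ?K \<Longrightarrow> y \<bullet> f y \<le> x \<bullet> f x"
    using continuous_attains_sup[of ?K "\<lambda>y. y \<bullet> f y"] by blast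
  define m where "m = x \<bullet> f x"
  define w where "w = m *\<^sub>R x - f x"
  have [simp]: "x \<bullet> x = 1" using x by (simp add: norm_eq_1)
  have form_nonneg: "0 \<le> m * (y \<bullet> y) - y \<bullet> f y" if "y \<in> S" for y
  proof (cases "y = 0")
    case False
    have "(y /\<^sub>R norm y) \<bullet> f (y /\<^sub>R norm y) \<le> m"
      using max[OF normalize[OF that False]] by (simp only: m_def)
    then have "(y \<bullet> f y) / (norm y)\<^sup>2 \<le> m"
      by (simp add: scale power2_eq_square field_simps)
    then show ?thesis
      using False by (simp add: field_simps flip: power2_norm_eq_inner)
  qed (simp add: zero)
  have "w \<in> S" using S x inv by (simp add: w_def subspace_diff subspace_scale)
  have "w \<bullet> w = 0"
  proof (rule nonneg_quadratic_no_linear_term)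
    fix s :: real
    have "x + s *\<^sub>R w \<in> S" using S x \<open>w \<in> S\<close> by (simp add: subspace_add subspace_scale)
    from form_nonneg[OF this]
    have "0 \<le> m * ((x + s *\<^sub>R w) \<bullet> (x + s *\<^sub>R w)) - (x + s *\<^sub>R w) \<bullet> f (x + s *\<^sub>R w)" .
    also have "\<dots> = 2 * s * (m * (x \<bullet> w) - f x \<bullet> w) + s\<^sup>2 * (m * (w \<bullet> w) - w \<bullet> f w)"
      using sa[of x w] inner_commute[of w "f x"]
      by (simp add: add scale inner_add_left inner_add_right inner_commute[of w x] m_def
          power2_eq_square algebra_simps)
    also have "m * (x \<bullet> w) - f x \<bullet> w = w \<bullet> w"
      by (simp add: w_def inner_diff_left)
    finally show "0 \<le> 2 * s * (w \<bullet> w) + s\<^sup>2 * (m * (w \<bullet> w) - w \<bullet> f w)" .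
  qed
  then have "f x = m *\<^sub>R x" by (simp add: w_def)
  with x that show thesis by auto
qed

lemma commuting_selfadjoint_eigenvector:
  fixes f g :: "'a::euclidean_space \<Rightarrow> 'a"
  assumes f: "linear f" "\<And>x y. f x \<bullet> y = x \<bullet> f y" "\<And>x. x \<in> S \<Longrightarrow> f x \<in> S"
    and g: "linear g" "\<And>x y. g x \<bullet> y = x \<bullet> g y" "\<And>x. x \<in> S \<Longrightarrow> g x \<in> S"
    and comm: "\<And>x. f (g x) = g (f x)"
    and S: "subspace S" "S \<noteq> {0}"
  obtains x l m where "x \<in> S" "norm x = 1" "f x = l *\<^sub>R x" "g x = m *\<^sub>R x"
proof -
  obtain y l where y: "y \<in> S" "norm y = 1" "f y = l *\<^sub>R y"
    using selfadjoint_eigenvector[OF f(1,2) S f(3)] by blast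
  let ?E = "{x \<in> S. f x = l *\<^sub>R x}"
  have "subspace ?E"
    using S f(1) by (auto simp: subspace_def linear_0 linear_add linear_cmul scaleR_add_right)
  moreover have "?E \<noteq> {0}"
  proof
    assume "?E = {0}"
    with y have "y = 0" by blast
    with y show False by simp
  qed
  moreover have "g x \<in> ?E" if "x \<in> ?E" for x
    using that g(1,3) comm by (auto simp: linear_cmul)
  ultimately obtain x m where "x \<in> ?E" "norm x = 1" "g x = m *\<^sub>R x"
    using selfadjoint_eigenvector[OF g(1,2)] by blast
  then show thesis using that by blast
qed

lemma commuting_selfadjoint_orthonormal_eigenbasis:
  fixes f g :: "'a::euclidean_space \<Rightarrow> 'a"
  assumes f: "linear f" "\<And>x y. f x \<bullet> y = x \<bullet> f y" "\<And>x. x \<in> S \<Longrightarrow> f x \<in> S"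
    and g: "linear g" "\<And>x y. g x \<bullet> y = x \<bullet> g y" "\<And>x. x \<in> S \<Longrightarrow> g x \<in> S"
    and comm: "\<And>x. f (g x) = g (f x)"
    and S: "subspace S"
  shows "\<exists>B\<subseteq>S. pairwise orthogonal B \<and> S \<subseteq> span B \<and>
           (\<forall>v\<in>B. norm v = 1 \<and> (\<exists>l. f v = l *\<^sub>R v) \<and> (\<exists>m. g v = m *\<^sub>R v))"
  using S f(3) g(3)
proof (induction "dim S" arbitrary: S rule: less_induct)
  case less
  show ?case
  proof (cases "S = {0}")
    case True
    then show ?thesis by (intro exI[of _ "{}"]) simp
  next
    case False
    obtain v l m where v: "v \<in> S" "norm v = 1" "f v = l *\<^sub>R v" "g v = m *\<^sub>R v"
      using commuting_selfadjoint_eigenvector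
        [OF f(1,2) less.prems(2) g(1,2) less.prems(3) comm less.prems(1) False] by blast
    let ?T = "S \<inter> {y. orthogonal v y}"
    have T: "subspace ?T"
      using less.prems(1) by (intro subspace_inter subspace_orthogonal_to_vector)
    have "v \<notin> ?T" using v by (auto simp: orthogonal_def norm_eq_1)
    then have "?T \<subset> S" using v by blast
    then have "span ?T \<subset> span S"
      using T less.prems(1) by (simp add: span_eq_iff[THEN iffD2])
    then have "dim ?T < dim S" by (rule dim_psubset)
    \<comment> \<open>self-adjointness moves the operator onto the eigenvector, so orthogonality is kept\<close>
    moreover have "f x \<in> ?T" if "x \<in> ?T" for x
      using that less.prems(2) v by (simp add: orthogonal_def flip: f(2))
    moreover have "g x \<in> ?T" if "x \<in> ?T" for x
      using that less.prems(3) v by (simp add: orthogonal_def flip: g(2))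
    ultimately obtain B where B: "B \<subseteq> ?T" "pairwise orthogonal B" "?T \<subseteq> span B"
      "\<forall>v\<in>B. norm v = 1 \<and> (\<exists>l. f v = l *\<^sub>R v) \<and> (\<exists>m. g v = m *\<^sub>R v)"
      using less.hyps[OF _ T] by blast
    have "x \<in> span (insert v B)" if "x \<in> S" for x
    proof -
      have "x - (v \<bullet> x) *\<^sub>R v \<in> ?T"
        using that v less.prems(1)
        by (simp add: subspace_diff subspace_scale orthogonal_def inner_diff_right norm_eq_1)
      then show ?thesis using B(3) by (auto simp: span_insert)
    qed
    moreover have "pairwise orthogonal (insert v B)"
      using B by (auto simp: pairwise_insert orthogonal_commute)
    ultimately show ?thesis
      using B v by (intro exI[of _ "insert v B"]) blast
  qed
qed

section \<open>Simultaneous diagonalization of commuting symmetric matrices\<close>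

lemma symmetric_matrix_selfadjoint:
  assumes "symmetric_matrix A"
  shows "(A *v x) \<bullet> y = x \<bullet> (A *v y)"
  using assms dot_lmul_matrix[of x A y]
  by (simp add: symmetric_matrix_def flip: transpose_matrix_vector)

lemma conjugate_entry:
  fixes U M :: "real^'n^'n"
  shows "(transpose U ** M ** U) $ i $ j = column i U \<bullet> (M *v column j U)"
proof -
  have "(transpose U ** (M ** U)) $ i $ j = column i U \<bullet> column j (M ** U)"
    by (simp add: matrix_matrix_mult_def transpose_def column_def inner_vec_def)
  also have "column j (M ** U) = M *v column j U"
    by (simp add: matrix_matrix_mult_def matrix_vector_mult_def column_def)
  finally show ?thesis by (simp add: matrix_mul_assoc)
qed

lemma diagonal_matrix_eigenvector_columns:
  fixes U M :: "real^'n^'n"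
  assumes "orthogonal_matrix U" "\<And>j. \<exists>l. M *v column j U = l *\<^sub>R column j U"
  shows "diagonal_matrix (transpose U ** M ** U)"
  unfolding diagonal_matrix_def conjugate_entry
proof (intro allI impI)
  fix i j :: 'n
  assume "i \<noteq> j"
  obtain l where "M *v column j U = l *\<^sub>R column j U" using assms by blast
  with \<open>i \<noteq> j\<close> show "column i U \<bullet> (M *v column j U) = 0"
    using assms(1) by (simp add: orthogonal_matrix_orthonormal_columns orthogonal_def)
qed

lemma commuting_symmetric_simultaneously_diagonalizable:
  fixes M N :: "real^'n^'n"
  assumes "symmetric_matrix M" "symmetric_matrix N" "M ** N = N ** M"
  shows "\<exists>U. simultaneously_diagonalizes U M N"
proof -
  have "M *v (N *v x) = N *v (M *v x)" for x
    using assms(3) by (simp add: matrix_vector_mul_assoc)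
  then obtain B where B: "pairwise orthogonal B" "span B = UNIV"
    and eig: "\<And>v. v \<in> B \<Longrightarrow> norm v = 1 \<and> (\<exists>l. M *v v = l *\<^sub>R v) \<and> (\<exists>m. N *v v = m *\<^sub>R v)"
    using commuting_selfadjoint_orthonormal_eigenbasis[of "(*v) M" UNIV "(*v) N"]
      symmetric_matrix_selfadjoint[OF assms(1)] symmetric_matrix_selfadjoint[OF assms(2)]
    by (auto simp: top_unique)
  have "independent B"
    using B(1) eig by (intro pairwise_orthogonal_independent) force+
  then have "finite B" "card B = CARD('n)"
    using B(2) dim_eq_card[of B UNIV] by (auto simp: independent_imp_finite)
  then obtain h :: "'n \<Rightarrow> real^'n" where h: "bij_betw h UNIV B"
    using finite_same_card_bij[of "UNIV :: 'n set" B] by auto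
  define U :: "real^'n^'n" where "U = (\<chi> i j. h j $ i)"
  have col: "column j U = h j" for j by (simp add: U_def column_def)
  have hB: "h j \<in> B" for j using h by (auto simp: bij_betw_def)
  have "orthogonal_matrix U"
    unfolding orthogonal_matrix_orthonormal_columns col
    using hB eig B(1) h by (auto simp: pairwise_def bij_betw_def inj_eq)
  then show ?thesis
    using eig hB unfolding simultaneously_diagonalizes_def
    by (intro exI[of _ U]) (auto intro!: diagonal_matrix_eigenvector_columns simp: col)
qed

section \<open>Weak duality in a diagonalizing basis\<close>

lemma symmetric_matrix_lin_comb:
  assumes "\<And>i. symmetric_matrix (A i)"
  shows "symmetric_matrix (lin_comb A q)"
  using assms by (simp add: symmetric_matrix_def lin_comb_def transpose_def vec_eq_iff)

lemma trace_inner_diff_left: "trace_inner (M - N) X = trace_inner M X - trace_inner N X"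
  by (simp add: trace_inner_def trace_def matrix_matrix_mult_def algebra_simps sum_subtractf)

lemma trace_inner_scaleR_left: "trace_inner (c *\<^sub>R M) X = c * trace_inner M X"
  by (simp add: trace_inner_def trace_def matrix_matrix_mult_def sum_distrib_left mult.assoc)

lemma trace_inner_lin_comb:
  "trace_inner (lin_comb A q) X = (\<Sum>j\<in>UNIV. q $ j * trace_inner (A j) X)"
proof -
  have linear: "linear (\<lambda>M. trace_inner M X)"
    by (rule linearI)
      (simp_all add: trace_inner_def trace_def matrix_matrix_mult_def
        algebra_simps sum.distrib sum_distrib_left)
  show ?thesis
    by (simp add: lin_comb_def linear_sum[OF linear] trace_inner_scaleR_left)
qed

text \<open>Conjugation by \<open>U\<close> preserves the trace inner product, and a diagonal factor sees only the
  diagonal of the other factor.\<close>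

lemma trace_inner_diagonalized:
  fixes U M X :: "real^'n^'n"
  assumes U: "orthogonal_matrix U" and diag: "diagonal_matrix (transpose U ** M ** U)"
  shows "trace_inner M X =
    (\<Sum>k\<in>UNIV. (column k U \<bullet> (M *v column k U)) * (column k U \<bullet> (X *v column k U)))"
proof -
  let ?D = "transpose U ** M ** U" and ?Y = "transpose U ** X ** U"
  have UU: "U ** transpose U = mat 1" using U by (simp add: orthogonal_matrix_def)
  have "?D ** ?Y = transpose U ** M ** (U ** transpose U) ** X ** U"
    by (simp only: matrix_mul_assoc)
  also have "\<dots> = transpose U ** (M ** X ** U)"
    by (simp add: UU matrix_mul_assoc)
  finally have "trace (?D ** ?Y) = trace (transpose U ** (M ** X ** U))"
    by (rule arg_cong)
  also have "\<dots> = trace (M ** X ** U ** transpose U)"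
    by (rule trace_mul_sym)
  also have "\<dots> = trace_inner M X"
    by (simp add: trace_inner_def UU flip: matrix_mul_assoc)
  finally have "trace_inner M X = trace (?D ** ?Y)" by simp
  also have "\<dots> = (\<Sum>k\<in>UNIV. \<Sum>j\<in>UNIV. ?D $ k $ j * ?Y $ j $ k)"
    by (simp add: trace_def matrix_matrix_mult_def)
  also have "\<dots> = (\<Sum>k\<in>UNIV. ?D $ k $ k * ?Y $ k $ k)"
  proof (rule sum.cong[OF refl])
    fix k
    have "(\<Sum>j\<in>UNIV. ?D $ k $ j * ?Y $ j $ k) = (\<Sum>j\<in>{k}. ?D $ k $ j * ?Y $ j $ k)"
      using diag by (intro sum.mono_neutral_right) (auto simp: diagonal_matrix_def)
    then show "(\<Sum>j\<in>UNIV. ?D $ k $ j * ?Y $ j $ k) = ?D $ k $ k * ?Y $ k $ k" by simp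
  qed
  finally show ?thesis by (simp only: conjugate_entry)
qed

lemma simultaneously_diagonalizes_shifted_pencil:
  fixes U C Q :: "real^'n^'n"
  assumes "simultaneously_diagonalizes U C Q"
  shows "diagonal_matrix (transpose U ** (C - x *\<^sub>R Q - t *\<^sub>R mat 1) ** U)"
proof -
  have "column i U \<bullet> column j U = 0" if "i \<noteq> j" for i j
    using assms that
    by (simp add: simultaneously_diagonalizes_def orthogonal_matrix_orthonormal_columns
        orthogonal_def)
  then show ?thesis
    using assms
    by (simp add: simultaneously_diagonalizes_def diagonal_matrix_def conjugate_entry
        matrix_vector_mult_diff_rdistrib inner_diff_right flip: scaleR_matrix_vector_assoc)
qed

theorem theorem3:
  fixes C :: "real^'n^'n"
    and A :: "'r::finite \<Rightarrow> real^'n^'n"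
    and b q1 q2 :: "real^'r"
  assumes "symmetric_matrix C"
    and "\<And>i. symmetric_matrix (A i)"
    and "sdp_strictly_feasible A b"
    and "dsdp_strictly_feasible C A"
    and "support q1 \<inter> support q2 = {}"
    and "lin_comb A q1 = mat 1"
    and "C ** lin_comb A q2 = lin_comb A q2 ** C"
  shows "(\<exists>U. simultaneously_diagonalizes U C (lin_comb A q2)) \<and>
    (\<forall>U. simultaneously_diagonalizes U C (lin_comb A q2) \<longrightarrow>
      (\<forall>x t :: real. pos_semidef (C - x *\<^sub>R lin_comb A q2 - t *\<^sub>R mat 1) \<longrightarrow>
        ereal ((\<Sum>j\<in>UNIV. b $ j * q2 $ j) * x + (\<Sum>j\<in>UNIV. b $ j * q1 $ j) * t)
          \<le> lp_optimal_value C A b (columns U)))"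
proof (intro conjI allI impI)
  show "\<exists>U. simultaneously_diagonalizes U C (lin_comb A q2)"
    using assms(1,2,7)
    by (intro commuting_symmetric_simultaneously_diagonalizable symmetric_matrix_lin_comb)
next
  fix U and x t :: real
  assume U: "simultaneously_diagonalizes U C (lin_comb A q2)"
    and M: "pos_semidef (C - x *\<^sub>R lin_comb A q2 - t *\<^sub>R mat 1)"
  let ?M = "C - x *\<^sub>R lin_comb A q2 - t *\<^sub>R mat 1"
  let ?bound = "(\<Sum>j\<in>UNIV. b $ j * q2 $ j) * x + (\<Sum>j\<in>UNIV. b $ j * q1 $ j) * t"
  have "?bound \<le> trace_inner C X" if "X \<in> lp_feasible A b (columns U)" for X
  proof -
    have feasible: "\<And>i. trace_inner (A i) X = b $ i"
        "\<And>k. 0 \<le> column k U \<bullet> (X *v column k U)"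
      using that by (auto simp: lp_feasible_def columns_def)
    have "0 \<le> (\<Sum>k\<in>UNIV. (column k U \<bullet> (?M *v column k U)) * (column k U \<bullet> (X *v column k U)))"
      using M feasible(2) by (intro sum_nonneg mult_nonneg_nonneg) (auto simp: pos_semidef_def)
    also have "\<dots> = trace_inner ?M X"
      using U simultaneously_diagonalizes_shifted_pencil[OF U]
      by (intro trace_inner_diagonalized[symmetric]) (auto simp: simultaneously_diagonalizes_def)
    also have "\<dots> = trace_inner C X - x * trace_inner (lin_comb A q2) X
        - t * trace_inner (lin_comb A q1) X"
      by (simp add: trace_inner_diff_left trace_inner_scaleR_left assms(6))
    also have "\<dots> = trace_inner C X - ?bound"
      by (simp add: trace_inner_lin_comb feasible(1) mult.commute)
    finally show ?thesis by simp
  qed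
  then show "ereal ?bound \<le> lp_optimal_value C A b (columns U)"
    unfolding lp_optimal_value_def by (intro INF_greatest) simp
qed

end
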